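(* Let $A\in[0,1]^{n\times n}$, $0<\lambda<1$, and let $(K,L)$ be a partition of $\{1,\dots,n\}$ with $K,L$ both nonempty. Then $A$ has a $(K,L)$ Łukasiewicz eigenvector associated with $\lambda$ if and only if $\rho(A_{KK})\le\lambda$ and $A^{(\lambda)}_{LK}\otimes(A^{(\lambda)}_{KK})^*\otimes\mathbf{0}_K\le\mathbf{0}_L$. In this case the set of $(K,L)$ eigenvectors associated with $\lambda$ is the set of vectors $x$ such that $$\mathbf{0}_L\le x_L\le \min\Big(\big(\mathcal{S}^{(1)}(K,\lambda,A)\big)^\sharp\otimes'\mathbf{0}_L,\ (1-\lambda)\otimes\mathbf{0}_L\Big)$$ (componentwise minimum) and $$x_K=(A^{(\lambda)}_{KK})^*\otimes\big(A^{(\lambda)}_{KL}\otimes x_L\oplus (1-\lambda)\otimes\mathbf{0}_K\oplus z_K\big)$$ for some vector $z_K\in(\mathbb{R}\cup\{-\infty\})^K$ satisfying $z_K\le\big(A^{(1)}_{LK}\otimes(A^{(\lambda)}_{KK})^*\big)^\sharp\otimes'\mathbf{0}_L$ and $(z_K)_i=-\infty$ for all $i\notin N_C(A_{KK},\lambda)$.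
   Context: Max-Łukasiewicz: $a\otimes_L b=\max(0,a+b-1)$, $(A\otimes_L x)_i=\max_j\max(0,a_{ij}+x_j-1)$, $(\lambda\otimes_L x)_i=\max(0,\lambda+x_i-1)$. A $(K,L)$ Łukasiewicz eigenvector associated with $\lambda$ is $x\in[0,1]^n$ with $A\otimes_L x=\lambda\otimes_L x$, $x_i\ge 1-\lambda$ for $i\in K$ and $x_i\le 1-\lambda$ for $i\in L$. For index sets $I,J$, $B_{IJ}$ is the submatrix with rows $I$ and columns $J$, $x_K$ the restriction of $x$ to $K$, and $\mathbf{0}_K$ the zero vector indexed by $K$. Tropical arithmetic: $a\oplus b=\max(a,b)$, $(B\otimes C)_{ik}=\max_j(b_{ij}+c_{jk})$, $(B\otimes' C)_{ik}=\min_j(b_{ij}+c_{jk})$, $(B^\sharp)_{ij}=-b_{ji}$, $\alpha\otimes v$ adds $\alpha$ to each component. $A^{(\alpha)}$ has entries $a_{ij}-\alpha$. $\rho(B)$ is the maximum cycle mean; for $\rho(B)\le 0$, $B^*=I\oplus B\oplus B^2\oplus\cdots$ (tropical powers, $I$ the tropical identity). The tropical Schur complement is $\mathcal{S}^{(1)}(K,\lambda,A)=A^{(1)}_{LL}\oplus A^{(1)}_{LK}\otimes(A^{(\lambda)}_{KK})^*\otimes A^{(\lambda)}_{KL}$. $N_C(A_{KK},\lambda)$ is empty if $\rho(A_{KK})\ne\lambda$, and if $\rho(A_{KK})=\lambda$ it is the node set of the critical graph of $A_{KK}$ (nodes lying on cycles of $A_{KK}$ with mean $\rho(A_{KK})$).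 *)

theory Defs
  imports "HOL-Analysis.Analysis"
begin

section \<open>Lukasiewicz arithmetic\<close>

definition luk :: "real \<Rightarrow> real \<Rightarrow> real" (infixl "\<otimes>\<^sub>L" 70)
  where "a \<otimes>\<^sub>L b = max 0 (a + b - 1)"

definition luk_mat_vec :: "real^'n^'n \<Rightarrow> real^'n \<Rightarrow> real^'n"
  where "luk_mat_vec A x = (\<chi> i. Max (range (\<lambda>j. A $ i $ j \<otimes>\<^sub>L x $ j)))"

definition luk_scale :: "real \<Rightarrow> real^'n \<Rightarrow> real^'n"
  where "luk_scale lam x = (\<chi> i. lam \<otimes>\<^sub>L x $ i)"

definition luk_eigenvector ::
    "'n set \<Rightarrow> 'n set \<Rightarrow> real^'n^'n \<Rightarrow> real \<Rightarrow> real^'n \<Rightarrow> bool"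
  where "luk_eigenvector K L A lam x \<longleftrightarrow>
    (\<forall>i. 0 \<le> x $ i \<and> x $ i \<le> 1) \<and>
    luk_mat_vec A x = luk_scale lam x \<and>
    (\<forall>i\<in>K. 1 - lam \<le> x $ i) \<and>
    (\<forall>i\<in>L. x $ i \<le> 1 - lam)"

section \<open>Tropical arithmetic\<close>

text \<open>
  Tropical scalars are extended reals. A matrix with rows \<open>I\<close> and columns \<open>J\<close> is a function
  of which only the values on \<open>I \<times> J\<close> matter, so the submatrix \<open>B\<^bsub>IJ\<^esub>\<close> is \<open>B\<close> itself, read on
  \<open>I \<times> J\<close>. Products therefore carry the index set over which they are contracted; the row and
  column sets of a result are fixed by the indices at which it is evaluated.

  Since \<open>\<infinity> + (-\<infinity>) = \<infinity>\<close> for extended reals, the max-plus operations below have their usual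
  meaning only on arguments that avoid \<open>\<infinity>\<close>, with \<open>-\<infinity>\<close> as tropical zero. In the min-plus
  operations, \<open>\<infinity>\<close> is absorbing, as it should be.
\<close>

type_synonym 'n tvec = "'n \<Rightarrow> ereal"
type_synonym 'n tmat = "'n \<Rightarrow> 'n \<Rightarrow> ereal"

definition trop_add :: "'n tmat \<Rightarrow> 'n tmat \<Rightarrow> 'n tmat" (infixl "\<oplus>" 65)
  where "B \<oplus> C = (\<lambda>i j. max (B i j) (C i j))"

definition trop_add_vec :: "'n tvec \<Rightarrow> 'n tvec \<Rightarrow> 'n tvec" (infixl "\<oplus>v" 65)
  where "v \<oplus>v w = (\<lambda>i. max (v i) (w i))"

definition trop_mult :: "'n tmat \<Rightarrow> 'n set \<Rightarrow> 'n tmat \<Rightarrow> 'n tmat" ("(_ \<otimes>\<^bsub>_\<^esub> _)" [70, 0, 71] 70)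
  where "B \<otimes>\<^bsub>J\<^esub> C = (\<lambda>i k. SUP j\<in>J. B i j + C j k)"

definition trop_mat_vec :: "'n tmat \<Rightarrow> 'n set \<Rightarrow> 'n tvec \<Rightarrow> 'n tvec" ("(_ \<otimes>v\<^bsub>_\<^esub> _)" [70, 0, 71] 70)
  where "B \<otimes>v\<^bsub>J\<^esub> v = (\<lambda>i. SUP j\<in>J. B i j + v j)"

definition min_mat_vec :: "'n tmat \<Rightarrow> 'n set \<Rightarrow> 'n tvec \<Rightarrow> 'n tvec" ("(_ \<otimes>''v\<^bsub>_\<^esub> _)" [70, 0, 71] 70)
  where "B \<otimes>'v\<^bsub>J\<^esub> v = (\<lambda>i. INF j\<in>J. B i j + v j)"

definition trop_scale :: "real \<Rightarrow> 'n tvec \<Rightarrow> 'n tvec"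
  where "trop_scale \<alpha> v = (\<lambda>i. ereal \<alpha> + v i)"

definition zero_vec :: "'n tvec" ("\<zero>v")
  where "\<zero>v = (\<lambda>_. 0)"

definition conjugate :: "'n tmat \<Rightarrow> 'n tmat" ("_\<^sup>\<sharp>" [1000] 999)
  where "B\<^sup>\<sharp> = (\<lambda>i j. - B j i)"

definition shift_mat :: "real^'n^'n \<Rightarrow> real \<Rightarrow> 'n tmat"
  where "shift_mat A \<alpha> = (\<lambda>i j. ereal (A $ i $ j - \<alpha>))"

definition tvec_of :: "real^'n \<Rightarrow> 'n tvec"
  where "tvec_of x = (\<lambda>i. ereal (x $ i))"

definition trop_id :: "'n tmat"
  where "trop_id = (\<lambda>i j. if i = j then 0 else -\<infinity>)"

primrec trop_power :: "'n set \<Rightarrow> 'n tmat \<Rightarrow> nat \<Rightarrow> 'n tmat"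
  where
    "trop_power K B 0 = trop_id"
  | "trop_power K B (Suc m) = trop_power K B m \<otimes>\<^bsub>K\<^esub> B"

text \<open>
  The Kleene star of \<open>B\<^bsub>KK\<^esub>\<close>, intended for maximum cycle mean at most \<open>0\<close>; otherwise the
  supremum can take the value \<open>\<infinity>\<close>.
\<close>

definition trop_star :: "'n set \<Rightarrow> 'n tmat \<Rightarrow> 'n tmat"
  where "trop_star K B = (\<lambda>i j. SUP m. trop_power K B m i j)"

section \<open>Cycles of \<open>A\<^bsub>KK\<^esub>\<close>\<close>

text \<open>
  The entries of \<open>A\<close> are real, hence all different from the tropical zero, so every pair of
  nodes of \<open>K\<close> is an edge of the digraph of \<open>A\<^bsub>KK\<^esub>\<close>. An elementary cycle is the list of
  its nodes; a singleton list is a loop.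
\<close>

definition is_cycle :: "'n set \<Rightarrow> 'n list \<Rightarrow> bool"
  where "is_cycle K c \<longleftrightarrow> c \<noteq> [] \<and> distinct c \<and> set c \<subseteq> K"

definition cycle_mean :: "real^'n^'n \<Rightarrow> 'n list \<Rightarrow> real"
  where "cycle_mean A c =
    (\<Sum>t<length c. A $ (c ! t) $ (c ! (Suc t mod length c))) / real (length c)"

definition max_cycle_mean :: "'n set \<Rightarrow> real^'n^'n \<Rightarrow> real"
  where "max_cycle_mean K A = Max (cycle_mean A ` {c. is_cycle K c})"

definition critical_nodes :: "'n set \<Rightarrow> real^'n^'n \<Rightarrow> 'n set"
  where "critical_nodes K A =
    {i. \<exists>c. is_cycle K c \<and> cycle_mean A c = max_cycle_mean K A \<and> i \<in> set c}"

definition N_C :: "'n set \<Rightarrow> real^'n^'n \<Rightarrow> real \<Rightarrow> 'n set"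
  where "N_C K A lam = (if max_cycle_mean K A = lam then critical_nodes K A else {})"

section \<open>Tropical Schur complement\<close>

text \<open>To be read on \<open>L \<times> L\<close>, where \<open>L\<close> is the complement of \<open>K\<close>.\<close>

definition schur1 :: "'n set \<Rightarrow> real \<Rightarrow> real^'n^'n \<Rightarrow> 'n tmat"
  where "schur1 K lam A =
    shift_mat A 1 \<oplus>
    shift_mat A 1 \<otimes>\<^bsub>K\<^esub> trop_star K (shift_mat A lam) \<otimes>\<^bsub>K\<^esub> shift_mat A lam"

end

theory Submission
  imports Defs
begin

text \<open>
  On \<open>K\<close> the eigenvector equation says that \<open>x\<^sub>K\<close> is a fixed point of
  \<open>y \<mapsto> B \<otimes> y \<oplus> u\<close>, where \<open>B\<close> is \<open>A\<^bsub>KK\<^esub>\<close> shifted by \<open>\<lambda>\<close> and \<open>u \<ge> 1 - \<lambda>\<close>; on \<open>L\<close> it is a system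
  of inequalities bounding \<open>x\<close> from above. The vector \<open>B\<^sup>* \<otimes> v\<close> is the least
  \<open>y \<ge> v\<close> with \<open>B \<otimes> y \<le> y\<close>. For such a subsolution \<open>y\<close>, the slacks \<open>y\<^sub>i - b\<^sub>i\<^sub>j - y\<^sub>j \<ge> 0\<close> along a
  cycle add up to minus its weight. Hence no cycle has positive weight, and on a cycle of weight
  zero every inequality is tight, which gives the fixed point equation at the critical nodes.
  Conversely, if a fixed point \<open>x\<close> exceeded \<open>B\<^sup>* \<otimes> (u \<oplus> z)\<close> somewhere, with \<open>z = x\<close> on the critical
  nodes, then following the entries where the maxima are attained would stay in the set of nodes
  where it does so and close up to a critical cycle there, a contradiction. Since \<open>L\<close> is nonempty,
  the second existence condition bounds \<open>B\<^sup>* \<otimes> (1 - \<lambda>)\<close>, and this vector, extended by zero to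
  \<open>L\<close>, is an eigenvector.
\<close>

section \<open>The Kleene star as a least solution\<close>

lemma trop_star_diag_nonneg: "0 \<le> trop_star K B i i"
  unfolding trop_star_def by (rule SUP_upper2[of 0]) (auto simp: trop_id_def)

text \<open>Powers grow by a factor on the right, whereas here an edge is prepended on the left; the
  induction passes it through the product. Finite entries \<open>b\<close> let the edge weight move
  inside the supremum.\<close>

lemma trop_power_step:
  fixes b :: "'n \<Rightarrow> 'n \<Rightarrow> real"
  defines "B \<equiv> \<lambda>i j. ereal (b i j)"
  assumes "i \<in> K" "j \<in> K"
  shows "B i j + trop_power K B m j k \<le> trop_power K B (Suc m) i k"
proof (induction m arbitrary: k)
  case 0
  show ?case
  proof (cases "j = k")
    case True
    have "B i j \<le> trop_power K B (Suc 0) i k"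
      unfolding trop_power.simps trop_mult_def
      by (rule SUP_upper2[OF assms(2)]) (auto simp: trop_id_def True)
    then show ?thesis using True by (simp add: trop_id_def)
  next
    case False
    then show ?thesis by (simp add: trop_id_def B_def)
  qed
next
  case (Suc m)
  have "B i j + trop_power K B (Suc m) j k
      = (SUP l\<in>K. B i j + (trop_power K B m j l + B l k))"
    using assms by (subst SUP_ereal_add_right) (auto simp: trop_mult_def)
  also have "\<dots> \<le> trop_power K B (Suc (Suc m)) i k"
  proof (rule SUP_least)
    fix l assume l: "l \<in> K"
    have "B i j + (trop_power K B m j l + B l k) \<le> trop_power K B (Suc m) i l + B l k"
      using Suc[of l] by (metis add.assoc add_right_mono)
    also have "\<dots> \<le> trop_power K B (Suc (Suc m)) i k"
      by (subst (2) trop_power.simps) (auto simp: trop_mult_def intro!: SUP_upper2[OF l])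
    finally show "B i j + (trop_power K B m j l + B l k) \<le> trop_power K B (Suc (Suc m)) i k" .
  qed
  finally show ?case .
qed

lemma trop_star_step:
  fixes b :: "'n \<Rightarrow> 'n \<Rightarrow> real"
  defines "B \<equiv> \<lambda>i j. ereal (b i j)"
  assumes "i \<in> K" "j \<in> K"
  shows "B i j + trop_star K B j k \<le> trop_star K B i k"
proof -
  have "B i j + trop_star K B j k = (SUP m. B i j + trop_power K B m j k)"
    unfolding trop_star_def by (subst SUP_ereal_add_right) (auto simp: B_def)
  also have "\<dots> \<le> trop_star K B i k"
    unfolding trop_star_def
    by (rule SUP_mono) (use trop_power_step[of i K j b, folded B_def] assms in blast)
  finally show ?thesis .
qed

text \<open>Weights telescope along paths: each edge weighs at most the drop of the potential
  \<open>y\<close> across it, hence so does every path. This keeps the star finite.\<close>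

lemma trop_star_le_potential:
  fixes b :: "'n \<Rightarrow> 'n \<Rightarrow> real" and y :: "'n \<Rightarrow> real"
  defines "B \<equiv> \<lambda>i j. ereal (b i j)"
  assumes sub: "\<And>i j. i \<in> K \<Longrightarrow> j \<in> K \<Longrightarrow> b i j + y j \<le> y i"
    and "i \<in> K" "j \<in> K"
  shows "trop_star K B i j \<le> ereal (y i - y j)"
proof -
  have "trop_power K B m i j \<le> ereal (y i - y j)" if "j \<in> K" for m j
    using that
  proof (induction m arbitrary: j)
    case 0
    then show ?case by (auto simp: trop_id_def)
  next
    case (Suc m)
    show ?case
      unfolding trop_power.simps trop_mult_def
    proof (rule SUP_least)
      fix k assume k: "k \<in> K"
      have "trop_power K B m i k + B k j \<le> ereal (y i - y k) + ereal (b k j)"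
        by (intro add_mono Suc.IH[OF k]) (simp add: B_def)
      also have "\<dots> \<le> ereal (y i - y j)" using sub[OF k Suc.prems] by simp
      finally show "trop_power K B m i k + B k j \<le> ereal (y i - y j)" .
    qed
  qed
  then show ?thesis unfolding trop_star_def using assms by (auto intro: SUP_least)
qed

lemma trop_star_real:
  fixes b :: "'n \<Rightarrow> 'n \<Rightarrow> real"
  defines "B \<equiv> \<lambda>i j. ereal (b i j)"
  assumes "i \<in> K" "j \<in> K" "trop_star K B i j \<noteq> \<infinity>"
  shows "trop_star K B i j = ereal (real_of_ereal (trop_star K B i j))"
proof -
  \<comment> \<open>The edge from \<open>i\<close> to \<open>j\<close> is itself a path of finite
    weight, which excludes \<open>-\<infinity>\<close>.\<close>
  have "B i j + 0 \<le> B i j + trop_star K B j j"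
    by (intro add_left_mono trop_star_diag_nonneg)
  also have "\<dots> \<le> trop_star K B i j"
    using trop_star_step[of i K j b] assms by blast
  finally have "trop_star K B i j \<noteq> -\<infinity>" by (auto simp: B_def)
  then show ?thesis using assms(4) by (cases "trop_star K B i j") auto
qed

section \<open>The star applied to a vector\<close>

lemma trop_star_vec_upper: "i \<in> K \<Longrightarrow> v i \<le> (trop_star K B \<otimes>v\<^bsub>K\<^esub> v) i"
  unfolding trop_mat_vec_def
  by (rule SUP_upper2[of i]) (use add_right_mono[OF trop_star_diag_nonneg, of "v i" K B i] in auto)

lemma trop_star_vec_step:
  fixes b :: "'n \<Rightarrow> 'n \<Rightarrow> real"
  defines "B \<equiv> \<lambda>i j. ereal (b i j)"
  assumes "i \<in> K" "j \<in> K"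
  shows "B i j + (trop_star K B \<otimes>v\<^bsub>K\<^esub> v) j \<le> (trop_star K B \<otimes>v\<^bsub>K\<^esub> v) i"
proof -
  have "B i j + (trop_star K B \<otimes>v\<^bsub>K\<^esub> v) j = (SUP k\<in>K. B i j + (trop_star K B j k + v k))"
    unfolding trop_mat_vec_def using assms by (subst SUP_ereal_add_right) auto
  also have "\<dots> = (SUP k\<in>K. B i j + trop_star K B j k + v k)"
    by (simp add: add.assoc)
  also have "\<dots> \<le> (trop_star K B \<otimes>v\<^bsub>K\<^esub> v) i"
    unfolding trop_mat_vec_def
    by (intro SUP_mono')
      (use trop_star_step[of i K j b, folded B_def] assms in \<open>blast intro: add_right_mono\<close>)
  finally show ?thesis .
qed

text \<open>The comparison vector \<open>y\<close> is real, so the telescoped difference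
  \<open>y i - y j\<close> cancels against the bound \<open>y j\<close>; \<open>v\<close> may still
  contain \<open>-\<infinity>\<close>.\<close>

lemma trop_star_vec_least:
  fixes b :: "'n \<Rightarrow> 'n \<Rightarrow> real" and y :: "'n \<Rightarrow> real"
  defines "B \<equiv> \<lambda>i j. ereal (b i j)"
  assumes sub: "\<And>i j. i \<in> K \<Longrightarrow> j \<in> K \<Longrightarrow> b i j + y j \<le> y i"
    and v: "\<And>i. i \<in> K \<Longrightarrow> v i \<le> ereal (y i)"
    and "i \<in> K"
  shows "(trop_star K B \<otimes>v\<^bsub>K\<^esub> v) i \<le> ereal (y i)"
  unfolding trop_mat_vec_def
proof (rule SUP_least)
  fix j assume j: "j \<in> K"
  have "trop_star K B i j + v j \<le> ereal (y i - y j) + ereal (y j)"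
    using trop_star_le_potential[OF sub \<open>i \<in> K\<close> j] v[OF j] unfolding B_def
    by (intro add_mono) auto
  then show "trop_star K B i j + v j \<le> ereal (y i)" by simp
qed

text \<open>If the value at \<open>i\<close> were not attained, lowering it alone would give a smaller subsolution.\<close>

lemma trop_star_vec_attained:
  fixes b :: "'n \<Rightarrow> 'n \<Rightarrow> real" and x :: "'n \<Rightarrow> real"
  defines "B \<equiv> \<lambda>i j. ereal (b i j)"
  assumes "finite K"
    and x: "\<And>i. i \<in> K \<Longrightarrow> ereal (x i) = (trop_star K B \<otimes>v\<^bsub>K\<^esub> v) i"
    and "i \<in> K"
  shows "ereal (x i) = v i \<or> (\<exists>j\<in>K. x i = b i j + x j)"
proof (rule ccontr)
  assume contra: "\<not> ?thesis"
  have v: "v j \<le> ereal (x j)" if "j \<in> K" for j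
    using trop_star_vec_upper[OF that, of v B] x[OF that] by simp
  have step: "b j k + x k \<le> x j" if "j \<in> K" "k \<in> K" for j k
    using trop_star_vec_step[OF that, of b v, folded B_def] that
    by (simp add: B_def x[folded B_def, symmetric, unfolded B_def])
  \<comment> \<open>\<open>M\<close> is the strongest lower bound that row \<open>i\<close> puts on
    the entry at \<open>i\<close>, the loop \<open>j = i\<close> included. The negated goal places
    it strictly below \<open>x i\<close>.\<close>
  define M where "M = Max (insert (v i) ((\<lambda>j. ereal (b i j + x j)) ` K))"
  have "M < ereal (x i)"
    unfolding M_def using contra v[OF \<open>i \<in> K\<close>] step[OF \<open>i \<in> K\<close>] \<open>finite K\<close>
    by (subst Max_less_iff) (auto simp: less_le)
  then obtain t where t: "M < ereal t" "t < x i" using ereal_dense2 by fastforce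
  have vt: "v i \<le> ereal t" and bt: "b i j + x j \<le> t" if "j \<in> K" for j
  proof -
    have "v i \<le> M" "ereal (b i j + x j) \<le> M"
      unfolding M_def using \<open>finite K\<close> that by (auto intro: Max_ge)
    then show "v i \<le> ereal t" "b i j + x j \<le> t"
      using t(1) by (auto dest: le_less_trans)
  qed
  \<comment> \<open>Rows other than \<open>i\<close> only gain from the smaller entry. For the loop,
    \<open>b i i + x i \<le> t < x i\<close> makes \<open>b i i\<close> negative, so its inequality
    survives the lowering as well.\<close>
  have "(trop_star K B \<otimes>v\<^bsub>K\<^esub> v) i \<le> ereal ((x(i := t)) i)"
    unfolding B_def
  proof (rule trop_star_vec_least[where y = "x(i := t)"])
    show "b k j + (x(i := t)) j \<le> (x(i := t)) k" if "k \<in> K" "j \<in> K" for k j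
      using step[OF that] bt[OF \<open>j \<in> K\<close>] bt[OF \<open>i \<in> K\<close>] t(2) by (auto split: if_splits)
    show "v k \<le> ereal ((x(i := t)) k)" if "k \<in> K" for k
      using v[OF that] vt[OF that] by auto
  qed fact
  then show False using t(2) by (simp flip: x[OF \<open>i \<in> K\<close>])
qed

section \<open>Cycles\<close>

lemma sum_cyclic_shift:
  fixes f :: "nat \<Rightarrow> 'a :: comm_monoid_add"
  shows "(\<Sum>t<n. f (Suc t mod n)) = (\<Sum>t<n. f t)"
proof (cases n)
  case (Suc m)
  have "(\<Sum>t<Suc m. f (Suc t mod Suc m)) = (\<Sum>t<m. f (Suc t mod Suc m)) + f 0" by simp
  also have "(\<Sum>t<m. f (Suc t mod Suc m)) = (\<Sum>t<m. f (Suc t))" by (rule sum.cong) auto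
  finally show ?thesis using Suc by (simp add: sum.lessThan_Suc_shift add.commute del: sum.lessThan_Suc)
qed simp

text \<open>Potential differences cancel around a closed cycle, so they can be added to the edges at
  no cost. For a subsolution \<open>x\<close> all summands become nonpositive, and on tight edges
  they vanish.\<close>

lemma cycle_mean_potential:
  fixes A :: "real^'n^'n" and x :: "'n \<Rightarrow> real"
  assumes "c \<noteq> []"
  shows "cycle_mean A c - lam =
    (\<Sum>t<length c. A $ (c ! t) $ (c ! (Suc t mod length c)) - lam
        + x (c ! (Suc t mod length c)) - x (c ! t)) / real (length c)"
  using sum_cyclic_shift[of "\<lambda>t. x (c ! t)" "length c"] assms
  by (simp add: cycle_mean_def sum.distrib sum_subtractf field_simps)

lemma finite_cycles: "finite K \<Longrightarrow> finite {c. is_cycle K c}"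
  by (rule finite_subset[OF _ finite_subset_distinct[of K]]) (auto simp: is_cycle_def)

lemma cycle_mean_le_max: "is_cycle K c \<Longrightarrow> cycle_mean A c \<le> max_cycle_mean K (A :: real^'n^'n)"
  unfolding max_cycle_mean_def by (rule Max_ge) (auto simp: finite_cycles)

lemma max_cycle_mean_le:
  fixes A :: "real^'n^'n" and y :: "'n \<Rightarrow> real"
  assumes "K \<noteq> {}" and sub: "\<And>i j. i \<in> K \<Longrightarrow> j \<in> K \<Longrightarrow> A $ i $ j - lam + y j \<le> y i"
  shows "max_cycle_mean K A \<le> lam"
proof -
  obtain k where "k \<in> K" using assms by auto
  \<comment> \<open>The loop at one node keeps the set of cycles nonempty, as the maximum
    requires.\<close>
  then have "is_cycle K [k]" by (simp add: is_cycle_def)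
  moreover have "cycle_mean A c \<le> lam" if c: "is_cycle K c" for c
  proof -
    have inK: "c ! t \<in> K" if "t < length c" for t using c that by (auto simp: is_cycle_def)
    have "(\<Sum>t<length c. A $ (c ! t) $ (c ! (Suc t mod length c)) - lam
        + y (c ! (Suc t mod length c)) - y (c ! t)) \<le> 0"
      using sub[OF inK inK[OF mod_less_divisor]] by (intro sum_nonpos) force
    then have "cycle_mean A c - lam \<le> 0"
      using c by (subst cycle_mean_potential[of c A lam y])
        (auto simp: is_cycle_def divide_nonpos_nonneg)
    then show ?thesis by simp
  qed
  ultimately show ?thesis
    unfolding max_cycle_mean_def by (subst Max_le_iff) (auto simp: finite_cycles)
qed

lemma critical_node_tight:
  fixes A :: "real^'n^'n" and y :: "'n \<Rightarrow> real"
  assumes "i \<in> N_C K A lam"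
    and sub: "\<And>i j. i \<in> K \<Longrightarrow> j \<in> K \<Longrightarrow> A $ i $ j - lam + y j \<le> y i"
  shows "\<exists>j\<in>K. y i = A $ i $ j - lam + y j"
proof -
  obtain c where c: "is_cycle K c" "cycle_mean A c = lam" "i \<in> set c"
    using assms(1) by (auto simp: N_C_def critical_nodes_def split: if_splits)
  then obtain s where s: "s < length c" "c ! s = i" by (auto simp: in_set_conv_nth)
  \<comment> \<open>\<open>d t\<close> is the slack of edge \<open>t\<close> on a critical cycle.
    Nonnegative slacks with sum zero all vanish, in particular the one on the edge leaving
    \<open>i\<close>.\<close>
  define d where "d t = y (c ! t) - (A $ (c ! t) $ (c ! (Suc t mod length c)) - lam
        + y (c ! (Suc t mod length c)))" for t
  have inK: "c ! t \<in> K" if "t < length c" for t using c that by (auto simp: is_cycle_def)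
  have "(\<Sum>t<length c. - d t) = 0"
    using cycle_mean_potential[of c A lam y] c s(1) by (auto simp: d_def is_cycle_def algebra_simps)
  then have "(\<Sum>t<length c. d t) = 0" by (simp add: sum_negf)
  moreover have "0 \<le> d t" if "t \<in> {..<length c}" for t
  proof -
    have "Suc t mod length c < length c" using that by (auto intro: mod_less_divisor)
    then show ?thesis using sub[OF inK inK] that by (simp add: d_def)
  qed
  ultimately have "d s = 0" using s(1) sum_nonneg_eq_0_iff[of "{..<length c}" d] by auto
  moreover have "c ! (Suc s mod length c) \<in> K" using s(1) by (intro inK mod_less_divisor) auto
  ultimately show ?thesis using s(2) by (auto simp: d_def)
qed

text \<open>Iteration inside a finite set must revisit a point; taking the least period of that
  point makes the cycle elementary, as \<open>is_cycle\<close> demands.\<close>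

lemma functional_cycle:
  assumes "finite S" "S \<noteq> {}" and f: "f ` S \<subseteq> S"
  obtains c where "c \<noteq> []" "distinct c" "set c \<subseteq> S"
    "\<And>t. t < length c \<Longrightarrow> c ! (Suc t mod length c) = f (c ! t)"
proof -
  obtain s where s: "s \<in> S" using assms by auto
  have iter: "(f ^^ n) i \<in> S" if "i \<in> S" for n i using that f by (induction n) auto
  have "\<not> inj (\<lambda>n. (f ^^ n) s)"
  proof
    assume "inj (\<lambda>n. (f ^^ n) s)"
    moreover have "range (\<lambda>n. (f ^^ n) s) \<subseteq> S" using iter[OF s] by auto
    ultimately show False using \<open>finite S\<close> finite_subset infinite_UNIV_nat finite_imageD by blast
  qed
  then obtain m n where mn: "m < n" "(f ^^ m) s = (f ^^ n) s"
    unfolding inj_def by (metis linorder_neqE_nat)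
  define i where "i = (f ^^ m) s"
  have i: "i \<in> S" using iter[OF s] by (simp add: i_def)
  have "(f ^^ (n - m)) i = (f ^^ (n - m + m)) s" by (simp add: i_def funpow_add)
  then have ex: "\<exists>p>0. (f ^^ p) i = i" using mn by (intro exI[of _ "n - m"]) (auto simp: i_def)
  define p where "p = (LEAST p. 0 < p \<and> (f ^^ p) i = i)"
  have p: "0 < p" "(f ^^ p) i = i" using LeastI_ex[OF ex] by (auto simp: p_def)
  have min: "(f ^^ q) i \<noteq> i" if "0 < q" "q < p" for q
    using not_less_Least[of q "\<lambda>p. 0 < p \<and> (f ^^ p) i = i"] that by (auto simp: p_def)
  have neq: "(f ^^ a) i \<noteq> (f ^^ b) i" if "a < b" "b < p" for a b
  proof
    assume eq: "(f ^^ a) i = (f ^^ b) i"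
    \<comment> \<open>A repetition within the period, continued for \<open>p - b\<close> steps,
      would return to \<open>i\<close> after \<open>p - b + a\<close> steps, a positive number below
      \<open>p\<close>.\<close>
    have "(f ^^ (p - b + a)) i = (f ^^ (p - b)) ((f ^^ b) i)" by (simp add: funpow_add eq)
    also have "\<dots> = (f ^^ (p - b + b)) i" by (subst funpow_add) simp
    also have "\<dots> = i" using that p by simp
    finally show False using min[of "p - b + a"] that by linarith
  qed
  show thesis
  proof (rule that[of "map (\<lambda>t. (f ^^ t) i) [0..<p]"])
    show "distinct (map (\<lambda>t. (f ^^ t) i) [0..<p])"
      using neq by (auto simp: distinct_map inj_on_def) (metis linorder_neqE_nat)
    fix t assume "t < length (map (\<lambda>t. (f ^^ t) i) [0..<p])"
    then have t: "t < p" by simp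
    show "map (\<lambda>t. (f ^^ t) i) [0..<p] ! (Suc t mod length (map (\<lambda>t. (f ^^ t) i) [0..<p]))
        = f (map (\<lambda>t. (f ^^ t) i) [0..<p] ! t)"
      using t p by (cases "Suc t = p") auto
  qed (use p iter[OF i] in auto)
qed

section \<open>The eigenvector equation in real arithmetic\<close>

text \<open>The right-hand side of the eigenvector equation is truncated to 0 on \<open>L\<close>
  and untruncated on \<open>K\<close>, so the equation becomes linear inequalities plus attainment
  on \<open>K\<close>. The range constraints are recovered: \<open>x \<le> 1\<close> from a row of
  the nonempty \<open>L\<close> with nonnegative entries, and \<open>0 \<le> x\<close> on
  \<open>K\<close> from \<open>lam < 1\<close>.\<close>

lemma luk_eigenvector_iff:
  fixes A :: "real^'n^'n"
  assumes nonneg: "\<And>i j. 0 \<le> A $ i $ j" and lam: "0 < lam" "lam < 1"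
    and KL: "K \<union> L = UNIV" "K \<inter> L = {}" and "L \<noteq> {}"
  shows "luk_eigenvector K L A lam x \<longleftrightarrow>
    (\<forall>i\<in>L. 0 \<le> x $ i \<and> x $ i \<le> 1 - lam) \<and> (\<forall>i\<in>K. 1 - lam \<le> x $ i) \<and>
    (\<forall>i\<in>L. \<forall>j. A $ i $ j + x $ j \<le> 1) \<and>
    (\<forall>i\<in>K. \<forall>j. A $ i $ j - lam + x $ j \<le> x $ i) \<and>
    (\<forall>i\<in>K. x $ i = 1 - lam \<or> (\<exists>j. x $ i = A $ i $ j - lam + x $ j))"
    (is "_ \<longleftrightarrow> ?R")
proof -
  have row: "luk_mat_vec A x $ i = luk_scale lam x $ i \<longleftrightarrow>
      (\<forall>j. A $ i $ j \<otimes>\<^sub>L x $ j \<le> lam \<otimes>\<^sub>L x $ i) \<and> (\<exists>j. A $ i $ j \<otimes>\<^sub>L x $ j = lam \<otimes>\<^sub>L x $ i)" for i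
    unfolding luk_mat_vec_def luk_scale_def vec_lambda_beta
    by (subst Max_eq_iff) (auto simp: image_iff eq_commute)
  have rowL: "luk_mat_vec A x $ i = luk_scale lam x $ i \<longleftrightarrow> (\<forall>j. A $ i $ j + x $ j \<le> 1)"
    if "x $ i \<le> 1 - lam" for i
  proof -
    have "lam \<otimes>\<^sub>L x $ i = 0" using that by (simp add: luk_def)
    moreover have "A $ i $ j \<otimes>\<^sub>L x $ j \<le> 0 \<longleftrightarrow> A $ i $ j + x $ j \<le> 1"
      "A $ i $ j \<otimes>\<^sub>L x $ j = 0 \<longleftrightarrow> A $ i $ j + x $ j \<le> 1" for j
      by (auto simp: luk_def)
    ultimately show ?thesis unfolding row by auto
  qed
  have rowK: "luk_mat_vec A x $ i = luk_scale lam x $ i \<longleftrightarrow>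
      (\<forall>j. A $ i $ j - lam + x $ j \<le> x $ i) \<and>
      (x $ i = 1 - lam \<or> (\<exists>j. x $ i = A $ i $ j - lam + x $ j))"
    if "1 - lam \<le> x $ i" for i
  proof -
    have "(A $ i $ j \<otimes>\<^sub>L x $ j \<le> lam \<otimes>\<^sub>L x $ i) \<longleftrightarrow> A $ i $ j - lam + x $ j \<le> x $ i" for j
      using that by (auto simp: luk_def)
    \<comment> \<open>Equality can also arise with both sides equal to 0, which happens only at the
      threshold \<open>x $ i = 1 - lam\<close>.\<close>
    moreover have "(A $ i $ j \<otimes>\<^sub>L x $ j = lam \<otimes>\<^sub>L x $ i) \<longleftrightarrow>
      x $ i = A $ i $ j - lam + x $ j \<or> x $ i = 1 - lam \<and> A $ i $ j - lam + x $ j \<le> x $ i" for j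
      using that by (auto simp: luk_def max_def)
    ultimately show ?thesis unfolding row by auto
  qed
  show ?thesis
  proof
    assume e: "luk_eigenvector K L A lam x"
    then have eq: "luk_mat_vec A x $ i = luk_scale lam x $ i" for i
      by (simp add: luk_eigenvector_def)
    have "\<forall>i\<in>L. x $ i \<le> 1 - lam" "\<forall>i\<in>K. 1 - lam \<le> x $ i" "\<forall>i. 0 \<le> x $ i"
      using e by (simp_all add: luk_eigenvector_def)
    then show ?R using rowL[THEN iffD1, OF _ eq] rowK[THEN iffD1, OF _ eq] by simp
  next
    assume r: ?R
    have "luk_mat_vec A x $ i = luk_scale lam x $ i" for i
    proof (cases "i \<in> K")
      case True
      then show ?thesis using r by (subst rowK) simp_all
    next
      case False
      then have "i \<in> L" using KL by blast
      then show ?thesis using r by (subst rowL) simp_all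
    qed
    moreover have "x $ i \<le> 1" for i
    proof -
      obtain l where "l \<in> L" using \<open>L \<noteq> {}\<close> by auto
      then have "A $ l $ i + x $ i \<le> 1" using r by simp
      then show ?thesis using nonneg[of l i] by simp
    qed
    moreover have "0 \<le> x $ i" for i
    proof (cases "i \<in> K")
      case True
      then have "1 - lam \<le> x $ i" using r by simp
      then show ?thesis using lam by simp
    next
      case False
      then have "i \<in> L" using KL by blast
      then show ?thesis using r by simp
    qed
    ultimately show "luk_eigenvector K L A lam x"
      using r by (simp add: luk_eigenvector_def vec_eq_iff)
  qed
qed

text \<open>In \<open>att\<close>, \<open>v\<close> accounts for whatever comes from outside
  \<open>K\<close>: a node needs a tight edge inside \<open>K\<close> only where \<open>v\<close>
  does not already dominate \<open>x\<close>.\<close>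

lemma le_trop_star_vec:
  fixes A :: "real^'n^'n" and x :: "'n \<Rightarrow> real"
  assumes sub: "\<And>i j. i \<in> K \<Longrightarrow> j \<in> K \<Longrightarrow> A $ i $ j - lam + x j \<le> x i"
    and att: "\<And>i. i \<in> K \<Longrightarrow> ereal (x i) \<le> v i \<or> (\<exists>j\<in>K. x i = A $ i $ j - lam + x j)"
    and crit: "\<And>i. i \<in> N_C K A lam \<Longrightarrow> ereal (x i) \<le> v i"
    and "i \<in> K"
  shows "ereal (x i) \<le> (trop_star K (shift_mat A lam) \<otimes>v\<^bsub>K\<^esub> v) i"
proof (rule ccontr)
  assume contra: "\<not> ?thesis"
  define w where "w = trop_star K (shift_mat A lam) \<otimes>v\<^bsub>K\<^esub> v"
  define S where "S = {i \<in> K. w i < ereal (x i)}"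
  have vw: "v i \<le> w i" if "i \<in> K" for i
    unfolding w_def using that by (rule trop_star_vec_upper)
  have step: "ereal (A $ i $ j - lam) + w j \<le> w i" if "i \<in> K" "j \<in> K" for i j
    unfolding w_def shift_mat_def using that by (rule trop_star_vec_step)
  \<comment> \<open>At a node of \<open>S\<close> domination by \<open>v\<close> fails, so a tight
    edge leaves it. Were its head \<open>j\<close> outside \<open>S\<close>, that edge would push
    \<open>w i\<close> up to \<open>x i\<close>.\<close>
  have "\<exists>j\<in>S. x i = A $ i $ j - lam + x j" if "i \<in> S" for i
  proof -
    have i: "i \<in> K" "w i < ereal (x i)" using that by (auto simp: S_def)
    then obtain j where j: "j \<in> K" "x i = A $ i $ j - lam + x j"
      using att[of i] vw[of i] by (auto dest: le_less_trans)
    have "w j < ereal (x j)"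
    proof (rule ccontr)
      assume "\<not> w j < ereal (x j)"
      then have "ereal (A $ i $ j - lam) + ereal (x j) \<le> ereal (A $ i $ j - lam) + w j"
        by (intro add_left_mono) simp
      also have "\<dots> \<le> w i" using step i(1) j(1) .
      finally show False using i(2) j(2) by simp
    qed
    then show ?thesis using j by (auto simp: S_def)
  qed
  then obtain f where f: "\<And>i. i \<in> S \<Longrightarrow> f i \<in> S \<and> x i = A $ i $ (f i) - lam + x (f i)" by metis
  have "S \<noteq> {}" using contra \<open>i \<in> K\<close> by (auto simp: S_def w_def)
  moreover have "f ` S \<subseteq> S" using f by auto
  ultimately obtain c where c: "c \<noteq> []" "distinct c" "set c \<subseteq> S"
    "\<And>t. t < length c \<Longrightarrow> c ! (Suc t mod length c) = f (c ! t)"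
    using functional_cycle[of S f] by (metis finite)
  \<comment> \<open>All edges of this cycle are tight for \<open>x\<close>, so with \<open>x\<close>
    as potential every summand vanishes.\<close>
  have "cycle_mean A c - lam = 0"
  proof -
    have "A $ (c ! t) $ (c ! (Suc t mod length c)) - lam
        + x (c ! (Suc t mod length c)) - x (c ! t) = 0" if "t < length c" for t
      using f[of "c ! t"] c(3) nth_mem[OF that] unfolding c(4)[OF that] by auto
    then show ?thesis by (subst cycle_mean_potential[OF c(1), of A lam x]) simp
  qed
  moreover have cyc: "is_cycle K c" using c by (auto simp: is_cycle_def S_def)
  moreover have "max_cycle_mean K A \<le> lam" by (rule max_cycle_mean_le) (use sub \<open>i \<in> K\<close> in auto)
  ultimately have "max_cycle_mean K A = lam" "cycle_mean A c = max_cycle_mean K A"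
    using cycle_mean_le_max[of K c A] by auto
  then have "hd c \<in> N_C K A lam"
    using cyc c(1) by (auto simp: N_C_def critical_nodes_def)
  \<comment> \<open>Any node of the cycle would do: criticality gives
    \<open>x \<le> v \<le> w\<close> there, against membership in \<open>S\<close>.\<close>
  moreover have "hd c \<in> S" using c by auto
  ultimately show False using crit[of "hd c"] vw[of "hd c"] by (auto simp: S_def)
qed

section \<open>Existence and description of the eigenvectors\<close>

lemma ereal_le_uminus_iff: "a \<le> - b \<longleftrightarrow> b \<le> - (a :: ereal)"
  by (metis ereal_minus_le_minus ereal_uminus_uminus)

lemma existence_condition_iff:
  "(shift_mat A lam \<otimes>\<^bsub>K\<^esub> S \<otimes>v\<^bsub>K\<^esub> \<zero>v) i \<le> \<zero>v i \<longleftrightarrow>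
    (\<forall>j\<in>K. \<forall>k\<in>K. ereal (A $ i $ j - lam) + S j k \<le> 0)"
  by (auto simp: trop_mat_vec_def trop_mult_def zero_vec_def shift_mat_def SUP_le_iff)

text \<open>Residuation: lying below the conjugate min-plus product means that each max-plus term
  with \<open>z\<close> is at most 0. The scalar \<open>z\<close> stays extended because it is
  \<open>-\<infinity>\<close> off the critical nodes.\<close>

lemma critical_bound_iff:
  assumes S: "\<And>j. j \<in> K \<Longrightarrow> S j i = ereal (s j i)" and z: "z \<noteq> \<infinity>"
  shows "z \<le> ((shift_mat A 1 \<otimes>\<^bsub>K\<^esub> S)\<^sup>\<sharp> \<otimes>'v\<^bsub>L\<^esub> \<zero>v) i \<longleftrightarrow>
    (\<forall>l\<in>L. \<forall>j\<in>K. ereal (A $ l $ j - 1 + s j i) + z \<le> 0)"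
proof -
  have "z \<le> - (SUP j\<in>K. ereal (A $ l $ j - 1) + S j i) \<longleftrightarrow>
    (\<forall>j\<in>K. ereal (A $ l $ j - 1 + s j i) + z \<le> 0)" for l
  proof -
    have "ereal r \<le> - z \<longleftrightarrow> ereal r + z \<le> 0" for r
      using z by (cases z) auto
    then show ?thesis
      by (subst ereal_le_uminus_iff) (simp add: SUP_le_iff S)
  qed
  then show ?thesis
    by (simp add: min_mat_vec_def conjugate_def trop_mult_def zero_vec_def shift_mat_def le_INF_iff)
qed

text \<open>Residuation again. The first family covers the direct edge from \<open>l\<close> to
  \<open>k\<close>, the second the detours that enter \<open>K\<close> at \<open>i\<close> and leave
  it from \<open>j\<close>.\<close>

lemma schur_bound_iff:
  assumes S: "\<And>i j. i \<in> K \<Longrightarrow> j \<in> K \<Longrightarrow> trop_star K (shift_mat A lam) i j = ereal (s i j)"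
  shows "ereal x \<le> ((schur1 K lam A)\<^sup>\<sharp> \<otimes>'v\<^bsub>L\<^esub> \<zero>v) k \<longleftrightarrow>
    (\<forall>l\<in>L. A $ l $ k + x \<le> 1 \<and>
      (\<forall>i\<in>K. \<forall>j\<in>K. A $ l $ i + s i j + (A $ j $ k - lam) + x \<le> 1))"
proof -
  have plus_le: "a + ereal r \<le> ereal q \<longleftrightarrow> a \<le> ereal (q - r)" for a r q
    by (cases a) auto
  have "ereal x \<le> - schur1 K lam A l k \<longleftrightarrow> A $ l $ k + x \<le> 1 \<and>
      (\<forall>i\<in>K. \<forall>j\<in>K. A $ l $ i + s i j + (A $ j $ k - lam) + x \<le> 1)" for l
  proof -
    have "ereal x \<le> - schur1 K lam A l k \<longleftrightarrow> schur1 K lam A l k \<le> ereal (- x)"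
      by (subst ereal_le_uminus_iff) simp
    also have "\<dots> \<longleftrightarrow> A $ l $ k + x \<le> 1 \<and>
      (\<forall>j\<in>K. \<forall>i\<in>K. A $ l $ i + s i j + (A $ j $ k - lam) + x \<le> 1)"
      by (simp add: schur1_def trop_add_def trop_mult_def shift_mat_def SUP_le_iff plus_le
          S[unfolded shift_mat_def])
        (simp add: algebra_simps)
    finally show ?thesis by blast
  qed
  then show ?thesis
    by (simp add: min_mat_vec_def conjugate_def zero_vec_def le_INF_iff)
qed

section \<open>The existence criterion\<close>

lemma luk_eigenvector_necessary:
  fixes A :: "real^'n^'n"
  assumes "\<And>i j. 0 \<le> A $ i $ j" "0 < lam" "lam < 1"
    and "K \<union> L = UNIV" "K \<inter> L = {}" "K \<noteq> {}" "L \<noteq> {}"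
    and e: "luk_eigenvector K L A lam x"
  shows "max_cycle_mean K A \<le> lam"
    and "i \<in> L \<Longrightarrow> (shift_mat A lam \<otimes>\<^bsub>K\<^esub> trop_star K (shift_mat A lam) \<otimes>v\<^bsub>K\<^esub> \<zero>v) i \<le> \<zero>v i"
proof -
  note x = luk_eigenvector_iff[of A lam K L x, THEN iffD1, OF assms(1-5,7) e]
  have sub: "A $ i $ j - lam + x $ j \<le> x $ i" if "i \<in> K" "j \<in> K" for i j
    using x that by blast
  show "max_cycle_mean K A \<le> lam"
    by (rule max_cycle_mean_le[where y = "\<lambda>i. x $ i"]) (use sub \<open>K \<noteq> {}\<close> in auto)
  assume i: "i \<in> L"
  \<comment> \<open>The eigenvector is its own potential, so the star entry is at most
    \<open>x $ j - x $ k\<close>. Row \<open>i\<close> in \<open>L\<close> caps \<open>x $ j\<close>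
    at \<open>1 - A $ i $ j\<close>, and \<open>k \<in> K\<close> gives
    \<open>1 - lam \<le> x $ k\<close>; the sum is then at most 0.\<close>
  have "ereal (A $ i $ j - lam) + trop_star K (shift_mat A lam) j k \<le> 0" if "j \<in> K" "k \<in> K" for j k
  proof -
    have "trop_star K (shift_mat A lam) j k \<le> ereal (x $ j - x $ k)"
      unfolding shift_mat_def using sub that by (intro trop_star_le_potential) auto
    then have "ereal (A $ i $ j - lam) + trop_star K (shift_mat A lam) j k
        \<le> ereal (A $ i $ j - lam) + ereal (x $ j - x $ k)" by (rule add_left_mono)
    also have "\<dots> \<le> 0"
    proof -
      have "A $ i $ j + x $ j \<le> 1" "1 - lam \<le> x $ k" using x i that by blast+
      then show ?thesis by simp
    qed
    finally show ?thesis .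
  qed
  then show "(shift_mat A lam \<otimes>\<^bsub>K\<^esub> trop_star K (shift_mat A lam) \<otimes>v\<^bsub>K\<^esub> \<zero>v) i \<le> \<zero>v i"
    by (simp add: existence_condition_iff)
qed

text \<open>The candidate is the star applied to the constant \<open>1 - lam\<close> on
  \<open>K\<close>, and zero on \<open>L\<close>. With zero there, the columns in \<open>L\<close>
  ask for no more than \<open>A \<le> 1\<close>.\<close>

lemma luk_eigenvector_exists:
  fixes A :: "real^'n^'n"
  assumes A: "\<And>i j. 0 \<le> A $ i $ j" "\<And>i j. A $ i $ j \<le> 1" and lam: "0 < lam" "lam < 1"
    and KL: "K \<union> L = UNIV" "K \<inter> L = {}" and "L \<noteq> {}"
    and cond: "\<And>i. i \<in> L \<Longrightarrow>
      (shift_mat A lam \<otimes>\<^bsub>K\<^esub> trop_star K (shift_mat A lam) \<otimes>v\<^bsub>K\<^esub> \<zero>v) i \<le> \<zero>v i"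
  shows "\<exists>x. luk_eigenvector K L A lam x"
proof -
  define v :: "'n \<Rightarrow> ereal" where "v = (\<lambda>_. ereal (1 - lam))"
  define w where "w = trop_star K (shift_mat A lam) \<otimes>v\<^bsub>K\<^esub> v"
  \<comment> \<open>Shifted by \<open>1 - lam\<close>, the existence condition is exactly the
    inequality that row \<open>i\<close> in \<open>L\<close> imposes on column
    \<open>j\<close>.\<close>
  have w_upper: "w j \<le> ereal (1 - A $ i $ j)" if "i \<in> L" "j \<in> K" for i j
    unfolding w_def trop_mat_vec_def
  proof (rule SUP_least)
    fix k assume "k \<in> K"
    then have "ereal (A $ i $ j - lam) + trop_star K (shift_mat A lam) j k \<le> 0"
      using cond[OF that(1)] that(2) by (simp add: existence_condition_iff)
    then show "trop_star K (shift_mat A lam) j k + v k \<le> ereal (1 - A $ i $ j)"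
      by (cases "trop_star K (shift_mat A lam) j k") (auto simp: v_def)
  qed
  have w_lower: "ereal (1 - lam) \<le> w j" if "j \<in> K" for j
    using trop_star_vec_upper[OF that, of v] by (simp add: w_def v_def)
  define x :: "real^'n" where "x = (\<chi> i. if i \<in> K then real_of_ereal (w i) else 0)"
  \<comment> \<open>A row of the nonempty \<open>L\<close> bounds \<open>w j\<close> above and
    \<open>1 - lam\<close> bounds it below, so \<open>real_of_ereal\<close> loses nothing.\<close>
  have xw: "ereal (x $ j) = w j" if "j \<in> K" for j
  proof -
    obtain i where "i \<in> L" using \<open>L \<noteq> {}\<close> by auto
    then show ?thesis
      using w_upper[of i j] w_lower[of j] that by (cases "w j") (auto simp: x_def)
  qed
  have xL: "x $ i = 0" if "i \<in> L" for i using that KL by (auto simp: x_def)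
  have lower: "1 - lam \<le> x $ i" if "i \<in> K" for i
    using w_lower[OF that] by (simp flip: xw[OF that])
  have "luk_eigenvector K L A lam x"
    unfolding luk_eigenvector_iff[OF A(1) lam KL \<open>L \<noteq> {}\<close>]
  proof (intro conjI ballI allI)
    show "A $ i $ j + x $ j \<le> 1" if "i \<in> L" for i j
    proof (cases "j \<in> K")
      case True
      show ?thesis using w_upper[OF that True] by (simp flip: xw[OF True])
    next
      case False
      then show ?thesis using A(2) by (simp add: x_def)
    qed
    show "A $ i $ j - lam + x $ j \<le> x $ i" if "i \<in> K" for i j
    proof (cases "j \<in> K")
      case True
      have "ereal (A $ i $ j - lam) + w j \<le> w i"
        unfolding w_def shift_mat_def using that True by (rule trop_star_vec_step)
      then show ?thesis by (simp flip: xw[OF True] xw[OF that])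
    next
      case False
      then show ?thesis using A(2)[of i j] lower[OF that] by (simp add: x_def)
    qed
    show "x $ i = 1 - lam \<or> (\<exists>j. x $ i = A $ i $ j - lam + x $ j)" if "i \<in> K" for i
    proof -
      have "ereal (x $ i) = v i \<or> (\<exists>j\<in>K. x $ i = A $ i $ j - lam + x $ j)"
        by (rule trop_star_vec_attained[where v = v])
          (use xw that in \<open>simp_all add: w_def shift_mat_def\<close>)
      then show ?thesis by (auto simp: v_def)
    qed
  qed (use lower xL lam in auto)
  then show ?thesis ..
qed

lemma luk_eigenvector_exists_iff:
  fixes A :: "real^'n^'n"
  assumes "\<And>i j. 0 \<le> A $ i $ j" "\<And>i j. A $ i $ j \<le> 1" "0 < lam" "lam < 1"
    and "K \<union> L = UNIV" "K \<inter> L = {}" "K \<noteq> {}" "L \<noteq> {}"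
  shows "(\<exists>x. luk_eigenvector K L A lam x) \<longleftrightarrow> max_cycle_mean K A \<le> lam \<and>
    (\<forall>i\<in>L. (shift_mat A lam \<otimes>\<^bsub>K\<^esub> trop_star K (shift_mat A lam) \<otimes>v\<^bsub>K\<^esub> \<zero>v) i \<le> \<zero>v i)"
    (is "?E \<longleftrightarrow> ?C")
proof
  assume ?E
  then obtain x where x: "luk_eigenvector K L A lam x" ..
  show ?C
    using luk_eigenvector_necessary[OF assms(1,3-8) x] by simp
next
  assume ?C
  then show ?E using assms by (intro luk_eigenvector_exists) simp_all
qed

section \<open>All eigenvectors, given that one exists\<close>

lemma luk_eigenvector_description:
  fixes A :: "real^'n^'n" and lam :: real
  defines "B \<equiv> shift_mat A lam"
  assumes A: "\<And>i j. 0 \<le> A $ i $ j" and lam: "0 < lam" "lam < 1"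
    and KL: "K \<union> L = UNIV" "K \<inter> L = {}" and K: "K \<noteq> {}" and L: "L \<noteq> {}"
    and e: "luk_eigenvector K L A lam y"
  shows "luk_eigenvector K L A lam x \<longleftrightarrow>
    (\<forall>i\<in>L. \<zero>v i \<le> tvec_of x i \<and>
      tvec_of x i \<le> min (((schur1 K lam A)\<^sup>\<sharp> \<otimes>'v\<^bsub>L\<^esub> \<zero>v) i) (trop_scale (1 - lam) \<zero>v i)) \<and>
    (\<exists>z :: 'n \<Rightarrow> ereal.
      (\<forall>i\<in>K. z i \<noteq> \<infinity>) \<and>
      (\<forall>i\<in>K. z i \<le> ((shift_mat A 1 \<otimes>\<^bsub>K\<^esub> trop_star K B)\<^sup>\<sharp> \<otimes>'v\<^bsub>L\<^esub> \<zero>v) i) \<and>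
      (\<forall>i\<in>K. i \<notin> N_C K A lam \<longrightarrow> z i = -\<infinity>) \<and>
      (\<forall>i\<in>K. tvec_of x i =
        (trop_star K B \<otimes>v\<^bsub>K\<^esub> (B \<otimes>v\<^bsub>L\<^esub> tvec_of x \<oplus>v trop_scale (1 - lam) \<zero>v \<oplus>v z)) i))"
    (is "_ \<longleftrightarrow> ?bounds \<and> (\<exists>z. ?z z)")
proof -
  note eig_iff = luk_eigenvector_iff[OF A lam KL L]
  note y = eig_iff[THEN iffD1, OF e]
  \<comment> \<open>The given eigenvector \<open>y\<close> acts as a potential: it makes the star
    real on \<open>K\<close> and yields the existence condition in the real form
    \<open>cond\<close>. The bound \<open>s_le\<close> leaves the potential \<open>u\<close> open,
    since an eigenvector \<open>x\<close> serves in the same way.\<close>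
  have sub_y: "A $ i $ j - lam + y $ j \<le> y $ i" if "i \<in> K" for i j
    using y that by blast
  define s where "s i j = real_of_ereal (trop_star K B i j)" for i j
  have star: "trop_star K B i j = ereal (s i j)" if "i \<in> K" "j \<in> K" for i j
  proof -
    have "trop_star K B i j \<le> ereal (y $ i - y $ j)"
      unfolding B_def shift_mat_def using sub_y that by (intro trop_star_le_potential) auto
    then have "trop_star K B i j \<noteq> \<infinity>" by auto
    then show ?thesis
      unfolding s_def B_def shift_mat_def using that by (intro trop_star_real)
  qed
  have s_le: "s i j \<le> u $ i - u $ j"
    if "i \<in> K" "j \<in> K" and "\<And>i j. i \<in> K \<Longrightarrow> j \<in> K \<Longrightarrow> A $ i $ j - lam + u $ j \<le> u $ i" for u i j
    using trop_star_le_potential[of K "\<lambda>i j. A $ i $ j - lam" "\<lambda>i. u $ i", OF that(3,1,2)]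
      star[OF that(1,2)] by (simp add: B_def shift_mat_def)
  have cond: "A $ i $ j + s j k + (1 - lam) \<le> 1" if "i \<in> L" "j \<in> K" "k \<in> K" for i j k
  proof -
    have "A $ i $ j + y $ j \<le> 1" "1 - lam \<le> y $ k" using y that by blast+
    then show ?thesis using s_le[of j k y] sub_y that by simp
  qed
  define v where "v z = (B \<otimes>v\<^bsub>L\<^esub> tvec_of x \<oplus>v trop_scale (1 - lam) \<zero>v \<oplus>v z)" for z
  have v_le_iff: "v z i \<le> t \<longleftrightarrow>
      (\<forall>k\<in>L. ereal (A $ i $ k - lam + x $ k) \<le> t) \<and> ereal (1 - lam) \<le> t \<and> z i \<le> t" for z i t
    by (auto simp: v_def trop_add_vec_def trop_mat_vec_def trop_scale_def zero_vec_def tvec_of_def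
        B_def shift_mat_def SUP_le_iff)
  \<comment> \<open>As \<open>L\<close> is finite and nonempty, the supremum over it is attained, so
    each entry of \<open>v z\<close> equals one of its ingredients.\<close>
  have v_cases: "(\<exists>k\<in>L. v z i = ereal (A $ i $ k - lam + x $ k)) \<or> v z i = ereal (1 - lam) \<or> v z i = z i"
    for z i
  proof -
    define F where "F = (\<lambda>k. ereal (A $ i $ k - lam + x $ k)) ` L"
    have "Sup F = Max F" using L by (intro cSup_eq_Max) (auto simp: F_def)
    moreover have "Max F \<in> F" using L by (intro Max_in) (auto simp: F_def)
    ultimately have "Sup F \<in> F" by simp
    moreover have "v z i = max (max (Sup F) (ereal (1 - lam))) (z i)"
      by (simp add: v_def trop_add_vec_def trop_mat_vec_def trop_scale_def zero_vec_def tvec_of_def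
        B_def shift_mat_def F_def)
    ultimately show ?thesis unfolding F_def max_def by auto
  qed
  have bounds: "?bounds \<longleftrightarrow> (\<forall>k\<in>L. 0 \<le> x $ k \<and> x $ k \<le> 1 - lam \<and> (\<forall>l\<in>L. A $ l $ k + x $ k \<le> 1 \<and>
      (\<forall>i\<in>K. \<forall>j\<in>K. A $ l $ i + s i j + (A $ j $ k - lam) + x $ k \<le> 1)))"
  proof -
    have "ereal (x $ k) \<le> ((schur1 K lam A)\<^sup>\<sharp> \<otimes>'v\<^bsub>L\<^esub> \<zero>v) k \<longleftrightarrow>
      (\<forall>l\<in>L. A $ l $ k + x $ k \<le> 1 \<and>
        (\<forall>i\<in>K. \<forall>j\<in>K. A $ l $ i + s i j + (A $ j $ k - lam) + x $ k \<le> 1))" for k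
      by (rule schur_bound_iff) (use star in \<open>simp add: B_def\<close>)
    then show ?thesis by (auto simp: tvec_of_def zero_vec_def trop_scale_def)
  qed
  have crit_iff: "z \<le> ((shift_mat A 1 \<otimes>\<^bsub>K\<^esub> trop_star K B)\<^sup>\<sharp> \<otimes>'v\<^bsub>L\<^esub> \<zero>v) i \<longleftrightarrow>
      (\<forall>l\<in>L. \<forall>j\<in>K. ereal (A $ l $ j - 1 + s j i) + z \<le> 0)" if "i \<in> K" "z \<noteq> \<infinity>" for z i
    by (rule critical_bound_iff) (use star that in auto)
  show ?thesis
  proof
    assume "luk_eigenvector K L A lam x"
    note x = eig_iff[THEN iffD1, OF this]
    have xL: "0 \<le> x $ i" "x $ i \<le> 1 - lam" "A $ i $ j + x $ j \<le> 1" if "i \<in> L" for i j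
      using x that by blast+
    have xK: "1 - lam \<le> x $ i" "A $ i $ j - lam + x $ j \<le> x $ i" if "i \<in> K" for i j
      using x that by blast+
    have ?bounds
      unfolding bounds
    proof (intro ballI conjI)
      fix k l i j assume *: "k \<in> L" "l \<in> L" "i \<in> K" "j \<in> K"
      \<comment> \<open>The whole detour telescopes: the star entry is at most
        \<open>x $ i - x $ j\<close>, the last edge at most \<open>x $ j - x $ k\<close>, and row
        \<open>l\<close> caps \<open>x $ i\<close>.\<close>
      then show "A $ l $ i + s i j + (A $ j $ k - lam) + x $ k \<le> 1"
        using s_le[OF *(3,4) xK(2)] xK(2)[OF *(4), of k] xL(3)[OF *(2), of i] by linarith
    qed (use xL in auto)
    \<comment> \<open>The witness copies \<open>x\<close> on the critical nodes, where closed chains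
      of tight edges may leave \<open>x\<close> unanchored by the other terms; elsewhere
      \<open>-\<infinity>\<close> is forced.\<close>
    moreover define \<zeta> where "\<zeta> i = (if i \<in> N_C K A lam then ereal (x $ i) else -\<infinity>)" for i
    have "?z \<zeta>"
    proof (intro conjI ballI)
      fix i assume i: "i \<in> K"
      show "\<zeta> i \<noteq> \<infinity>" by (simp add: \<zeta>_def)
      show "\<zeta> i \<le> ((shift_mat A 1 \<otimes>\<^bsub>K\<^esub> trop_star K B)\<^sup>\<sharp> \<otimes>'v\<^bsub>L\<^esub> \<zero>v) i"
      proof (cases "i \<in> N_C K A lam")
        case True
        have "ereal (A $ l $ j - 1 + s j i) + ereal (x $ i) \<le> 0" if "l \<in> L" "j \<in> K" for l j
          using s_le[OF that(2) i xK(2)] xL(3)[OF that(1), of j] by simp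
        then show ?thesis
          using True crit_iff[OF i, of "ereal (x $ i)"] by (simp add: \<zeta>_def)
      qed (simp add: \<zeta>_def)
      have "tvec_of x i = (trop_star K B \<otimes>v\<^bsub>K\<^esub> v \<zeta>) i"
      proof (rule antisym)
        show "(trop_star K B \<otimes>v\<^bsub>K\<^esub> v \<zeta>) i \<le> tvec_of x i"
          unfolding B_def shift_mat_def tvec_of_def
          by (rule trop_star_vec_least[where y = "\<lambda>i. x $ i"])
            (use xK i in \<open>auto simp: v_le_iff \<zeta>_def\<close>)
        have ge: "ereal (A $ j $ k - lam + x $ k) \<le> v \<zeta> j" "ereal (1 - lam) \<le> v \<zeta> j"
          "\<zeta> j \<le> v \<zeta> j" if "k \<in> L" for j k
          using v_le_iff[of \<zeta> j "v \<zeta> j"] that by blast+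
        obtain l where l: "l \<in> L" using L by auto
        show "tvec_of x i \<le> (trop_star K B \<otimes>v\<^bsub>K\<^esub> v \<zeta>) i"
          unfolding B_def tvec_of_def
        proof (rule le_trop_star_vec[where x = "\<lambda>i. x $ i"])
          show "ereal (x $ j) \<le> v \<zeta> j" if "j \<in> N_C K A lam" for j
            using ge(3)[OF l, of j] that by (simp add: \<zeta>_def)
          show "ereal (x $ j) \<le> v \<zeta> j \<or> (\<exists>k\<in>K. x $ j = A $ j $ k - lam + x $ k)"
            if "j \<in> K" for j
          proof -
            have "x $ j = 1 - lam \<or> (\<exists>k. x $ j = A $ j $ k - lam + x $ k)"
              using x that by blast
            \<comment> \<open>A tight edge into \<open>K\<close> serves directly; one into
              \<open>L\<close> is a term of \<open>v \<zeta>\<close>, and so is the threshold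
              \<open>1 - lam\<close>.\<close>
            then show ?thesis using ge(1)[of _ j] ge(2)[OF l, of j] KL by (metis UNIV_I Un_iff)
          qed
        qed (use xK i in auto)
      qed
      then show "tvec_of x i = (trop_star K B \<otimes>v\<^bsub>K\<^esub>
          (B \<otimes>v\<^bsub>L\<^esub> tvec_of x \<oplus>v trop_scale (1 - lam) \<zero>v \<oplus>v \<zeta>)) i"
        by (simp only: v_def)
    qed (simp add: \<zeta>_def)
    then have "\<exists>z. ?z z" by - (rule exI[of _ \<zeta>])
    ultimately show "?bounds \<and> (\<exists>z. ?z z)" by (rule conjI)
  next
    assume asm: "?bounds \<and> (\<exists>z. ?z z)"
    then have b: "?bounds" by (rule conjunct1)
    from asm have "\<exists>z. ?z z" by (rule conjunct2)
    then obtain z where z: "?z z" by (rule exE)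
    have xL: "0 \<le> x $ k" "x $ k \<le> 1 - lam" "l \<in> L \<Longrightarrow> A $ l $ k + x $ k \<le> 1"
      "l \<in> L \<Longrightarrow> i \<in> K \<Longrightarrow> j \<in> K \<Longrightarrow> A $ l $ i + s i j + (A $ j $ k - lam) + x $ k \<le> 1"
      if "k \<in> L" for k l i j
      using that b unfolding bounds by simp_all
    have zbound: "ereal (A $ l $ j - 1 + s j i) + z i \<le> 0" if "i \<in> K" "l \<in> L" "j \<in> K" for i l j
      using z that crit_iff[OF \<open>i \<in> K\<close>, of "z i"] by simp
    have zcrit: "i \<in> N_C K A lam" if "i \<in> K" "z i \<noteq> -\<infinity>" for i
      using z that by auto
    have xeq: "ereal (x $ i) = (trop_star K B \<otimes>v\<^bsub>K\<^esub> v z) i" if "i \<in> K" for i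
      using z that by (simp add: v_def tvec_of_def)
    have vx: "v z i \<le> ereal (x $ i)" if "i \<in> K" for i
      using trop_star_vec_upper[OF that, of "v z" B] xeq[OF that] by simp
    have ge: "1 - lam \<le> x $ i" "k \<in> L \<Longrightarrow> A $ i $ k - lam + x $ k \<le> x $ i" if "i \<in> K" for i k
      using vx[OF that] unfolding v_le_iff by auto
    have sub: "A $ i $ j - lam + x $ j \<le> x $ i" if "i \<in> K" "j \<in> K" for i j
      using trop_star_vec_step[of i K j "\<lambda>i j. A $ i $ j - lam" "v z"] that
      by (simp add: xeq[unfolded B_def shift_mat_def, symmetric])
    show "luk_eigenvector K L A lam x"
      unfolding eig_iff
    proof (intro conjI ballI allI)
      fix i j assume i: "i \<in> K"
      show "1 - lam \<le> x $ i" using ge(1)[OF i] .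
      show "A $ i $ j - lam + x $ j \<le> x $ i"
        using sub[OF i] ge(2)[OF i] KL by blast
      show "x $ i = 1 - lam \<or> (\<exists>j. x $ i = A $ i $ j - lam + x $ j)"
      proof -
        have "ereal (x $ i) = v z i \<or> (\<exists>j\<in>K. x $ i = A $ i $ j - lam + x $ j)"
          by (rule trop_star_vec_attained[where v = "v z"])
            (use xeq i in \<open>simp_all add: B_def shift_mat_def\<close>)
        \<comment> \<open>If \<open>z\<close> attains the entry, it is finite there, so
          \<open>i\<close> is critical; every subsolution is tight at a critical node.\<close>
        moreover have "\<exists>j\<in>K. x $ i = A $ i $ j - lam + x $ j" if "ereal (x $ i) = z i"
        proof -
          have "i \<in> N_C K A lam" using zcrit[OF i] that by (metis MInfty_neq_ereal(1))
          then show ?thesis using critical_node_tight[of i K A lam "\<lambda>i. x $ i"] sub by blast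
        qed
        ultimately show ?thesis using v_cases[of z i] by auto
      qed
    next
      fix l j assume l: "l \<in> L"
      show "0 \<le> x $ l" "x $ l \<le> 1 - lam" using xL l by blast+
      show "A $ l $ j + x $ j \<le> 1"
      proof (cases "j \<in> L")
        case True
        then show ?thesis using xL(3) l by blast
      next
        case False
        then have j: "j \<in> K" using KL by blast
        have "ereal (x $ j) \<le> ereal (1 - A $ l $ j)"
          unfolding xeq[OF j] trop_mat_vec_def
        proof (rule SUP_least)
          fix k assume k: "k \<in> K"
          \<comment> \<open>The three parts of \<open>v z\<close> are controlled by the Schur
            complement, the existence condition and the bound on \<open>z\<close> respectively.
            Adding \<open>s j k\<close> leaves the inequality of row \<open>l\<close>.\<close>
          have "v z k \<le> ereal (1 - A $ l $ j - s j k)"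
            unfolding v_le_iff
          proof (intro conjI ballI)
            show "ereal (A $ k $ m - lam + x $ m) \<le> ereal (1 - A $ l $ j - s j k)" if "m \<in> L" for m
              using xL(4)[OF that l j k] by simp
            show "ereal (1 - lam) \<le> ereal (1 - A $ l $ j - s j k)" using cond[OF l j k] by simp
            show "z k \<le> ereal (1 - A $ l $ j - s j k)"
              using zbound[OF k l j] by (cases "z k") auto
          qed
          then have "trop_star K B j k + v z k \<le> ereal (s j k) + ereal (1 - A $ l $ j - s j k)"
            unfolding star[OF j k] by (rule add_left_mono)
          then show "trop_star K B j k + v z k \<le> ereal (1 - A $ l $ j)" by simp
        qed
        then show ?thesis by simp
      qed
    qed
  qed
qed

theorem theorem13:
  fixes A :: "real^'n^'n" and lam :: real and K L :: "'n set"
  assumes "\<forall>i j. 0 \<le> A $ i $ j \<and> A $ i $ j \<le> 1"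
    and "0 < lam" and "lam < 1"
    and "K \<union> L = UNIV" and "K \<inter> L = {}" and "K \<noteq> {}" and "L \<noteq> {}"
  shows
    "((\<exists>x. luk_eigenvector K L A lam x) \<longleftrightarrow>
        max_cycle_mean K A \<le> lam \<and>
        (\<forall>i\<in>L. (shift_mat A lam \<otimes>\<^bsub>K\<^esub> trop_star K (shift_mat A lam) \<otimes>v\<^bsub>K\<^esub> \<zero>v) i \<le> \<zero>v i)) \<and>
     ((\<exists>x. luk_eigenvector K L A lam x) \<longrightarrow>
        {x. luk_eigenvector K L A lam x} =
        {x. (\<forall>i\<in>L. \<zero>v i \<le> tvec_of x i \<and>
                tvec_of x i \<le>
                  min (((schur1 K lam A)\<^sup>\<sharp> \<otimes>'v\<^bsub>L\<^esub> \<zero>v) i) (trop_scale (1 - lam) \<zero>v i)) \<and>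
            (\<exists>z :: 'n \<Rightarrow> ereal.
                (\<forall>i\<in>K. z i \<noteq> \<infinity>) \<and>
                (\<forall>i\<in>K. z i \<le>
                  ((shift_mat A 1 \<otimes>\<^bsub>K\<^esub> trop_star K (shift_mat A lam))\<^sup>\<sharp> \<otimes>'v\<^bsub>L\<^esub> \<zero>v) i) \<and>
                (\<forall>i\<in>K. i \<notin> N_C K A lam \<longrightarrow> z i = -\<infinity>) \<and>
                (\<forall>i\<in>K. tvec_of x i =
                  (trop_star K (shift_mat A lam) \<otimes>v\<^bsub>K\<^esub>
                    (shift_mat A lam \<otimes>v\<^bsub>L\<^esub> tvec_of x \<oplus>v trop_scale (1 - lam) \<zero>v \<oplus>v z)) i))})"
proof -
  have A: "0 \<le> A $ i $ j" "A $ i $ j \<le> 1" for i j using assms(1) by simp_all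
  show ?thesis
    \<comment> \<open>The eigenvector eliminated from the existence hypothesis plays the role of
      \<open>y\<close>.\<close>
    by (intro conjI impI Collect_cong luk_eigenvector_exists_iff[OF A assms(2-7)], elim exE)
      (rule luk_eigenvector_description[OF A(1) assms(2-7)])
qed

end
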